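(* Let $f\colon\mathbb{R}^n\to\mathbb{R}^n$, $g\colon\mathbb{R}^n\to\mathbb{R}^{n,m}$, $h\colon\mathbb{R}^n\to\mathbb{R}^m$ be continuous with $f(0)=0$, let $\mathbf{Q},\mathbf{R}\in\mathbb{R}^{m,m}$ be symmetric positive semidefinite with $\mathbf{R}$ invertible, and let $\hat{\mathcal{H}}$ be the value function of the infinite-horizon optimal control problem with running cost $\tfrac12(y^{\mathsf T}\mathbf{Q}y+u^{\mathsf T}\mathbf{R}u)$ described in the context. Assume that the set of admissible controls $\mathcal{U}_{\mathrm{ad}}(z_0)$ is nonempty for every $z_0\in\mathbb{R}^n$, that $\hat{\mathcal{H}}$ is continuously differentiable, and that the feedback law $u^*(z)=-\mathbf{R}^{-1}g(z)^{\mathsf T}\nabla\hat{\mathcal{H}}(z)$ is an optimal control for this problem. Then the system $$\dot{\hat z}=f(\hat z)-g(\hat z)\mathbf{R}^{-1}g(\hat z)^{\mathsf T}\nabla\hat{\mathcal{H}}(\hat z)+g(\hat z)\mathbf{R}^{-1/2}\big(\hat u-\mathbf{Q}^{1/2}h(\hat z)\big),\qquad \hat y=\mathbf{R}^{-1/2}g(\hat z)^{\mathsf T}\nabla\hat{\mathcal{H}}(\hat z),$$ with initial condition $\hat z(0)=\hat z_0$, input $\hat u$ and output $\hat y$, is passive with storage function $\hat{\mathcal{H}}\ge 0$.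
   Context: The plant is the control system $\dot z(t)=f(z(t))+g(z(t))u(t)$, $z(0)=z_0$, $y(t)=h(z(t))$, for $t\ge 0$, with state $z(t)\in\mathbb{R}^n$, input $u(t)\in\mathbb{R}^m$, output $y(t)\in\mathbb{R}^m$. Standing assumption: its solutions exist on $[0,\infty)$ in the sense of Carathéodory. The optimal control problem is $$\hat{\mathcal{H}}(z_0)=\inf_{u\in\mathcal{U}_{\mathrm{ad}}(z_0)}\frac12\int_0^\infty y^{\mathsf T}\mathbf{Q}y+u^{\mathsf T}\mathbf{R}u\,\mathrm{d}t$$ subject to the plant dynamics with $z(0)=z_0$, where $\mathcal{U}_{\mathrm{ad}}(z_0)$ is the set of $u\in L^2([0,\infty),\mathbb{R}^m)$ for which this integral is finite. The function $\hat{\mathcal{H}}\colon\mathbb{R}^n\to\mathbb{R}_{\ge0}$ is called the value function. A system with state $z$, input $u$ and output $y$ is passive with storage function $\mathcal{H}\colon\mathbb{R}^n\to\mathbb{R}_{\ge0}$ if $\mathcal{H}(z(t_1))-\mathcal{H}(z(t_0))\le\int_{t_0}^{t_1}y(t)^{\mathsf T}u(t)\,\mathrm{d}t$ for all $t_1\ge t_0\ge0$ and all controls $u$ along solutions of the system. *)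

theory Defs
  imports "HOL-Analysis.Analysis"
begin

definition sym_pos_semidef :: "real^'k^'k \<Rightarrow> bool" where
  "sym_pos_semidef A \<longleftrightarrow> transpose A = A \<and> (\<forall>x. 0 \<le> x \<bullet> (A *v x))"

text \<open>The root $A^{1/2}$ of a symmetric positive semidefinite matrix is its unique symmetric
  positive semidefinite square root; the value is unspecified for other matrices.\<close>

definition matrix_sqrt :: "real^'k^'k \<Rightarrow> real^'k^'k" where
  "matrix_sqrt A = (THE S. sym_pos_semidef S \<and> S ** S = A)"

definition gradient :: "('z::real_inner \<Rightarrow> real) \<Rightarrow> 'z \<Rightarrow> 'z" where
  "gradient H z = (THE D. GDERIV H z :> D)"

definition continuously_differentiable :: "('z::real_inner \<Rightarrow> real) \<Rightarrow> bool" where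
  "continuously_differentiable H \<longleftrightarrow>
     (\<forall>z. H differentiable (at z)) \<and> continuous_on UNIV (gradient H)"

text \<open>Solutions of $\dot z = F(z,u)$, $z(0) = z_0$ on a time interval \<open>I\<close> with left end point 0,
  in the sense of Caratheodory. The integral equation says that \<open>z\<close> is (locally) absolutely
  continuous with $\dot z(t) = F(z(t),u(t))$ for almost every \<open>t\<close>. Solutions need not be unique.\<close>

definition caratheodory_solution ::
  "('z::euclidean_space \<Rightarrow> 'u \<Rightarrow> 'z) \<Rightarrow> real set \<Rightarrow> 'z \<Rightarrow> (real \<Rightarrow> 'u) \<Rightarrow> (real \<Rightarrow> 'z) \<Rightarrow> bool" where
  "caratheodory_solution F I z0 u z \<longleftrightarrow>
     (\<forall>t\<in>I. (\<lambda>s. F (z s) (u s)) absolutely_integrable_on {0..t} \<and>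
            z t = z0 + integral {0..t} (\<lambda>s. F (z s) (u s)))"

definition L2_controls :: "(real \<Rightarrow> real^'m) set" where
  "L2_controls = {u. u \<in> borel_measurable (lebesgue_on {0..}) \<and>
     (\<lambda>t. (norm (u t))\<^sup>2) absolutely_integrable_on {0..}}"

definition plant ::
  "(real^'n \<Rightarrow> real^'n) \<Rightarrow> (real^'n \<Rightarrow> real^'m^'n) \<Rightarrow> real^'n \<Rightarrow> real^'m \<Rightarrow> real^'n" where
  "plant f g z u = f z + g z *v u"

definition running_cost ::
  "(real^'n \<Rightarrow> real^'m) \<Rightarrow> real^'m^'m \<Rightarrow> real^'m^'m \<Rightarrow> real^'n \<Rightarrow> real^'m \<Rightarrow> real" where
  "running_cost h Q R z u = h z \<bullet> (Q *v h z) + u \<bullet> (R *v u)"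

definition total_cost ::
  "(real^'n \<Rightarrow> real^'m) \<Rightarrow> real^'m^'m \<Rightarrow> real^'m^'m \<Rightarrow>
   (real \<Rightarrow> real^'m) \<Rightarrow> (real \<Rightarrow> real^'n) \<Rightarrow> real" where
  "total_cost h Q R u z = (1/2) * integral {0..} (\<lambda>t. running_cost h Q R (z t) (u t))"

text \<open>As solutions for a given control may fail to be unique (\<open>f\<close> and \<open>g\<close> are only continuous),
  the optimal control problem ranges over pairs of a control and a corresponding solution. If
  solutions are unique, this is the same as ranging over the admissible controls. The running cost
  is nonnegative and measurable along a solution, so integrability means that its integral is
  finite; solutions with infinite cost do not affect the infimum.\<close>

definition admissible_pair ::
  "(real^'n \<Rightarrow> real^'n) \<Rightarrow> (real^'n \<Rightarrow> real^'m^'n) \<Rightarrow> (real^'n \<Rightarrow> real^'m) \<Rightarrow>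
   real^'m^'m \<Rightarrow> real^'m^'m \<Rightarrow> real^'n \<Rightarrow> (real \<Rightarrow> real^'m) \<Rightarrow> (real \<Rightarrow> real^'n) \<Rightarrow> bool" where
  "admissible_pair f g h Q R z0 u z \<longleftrightarrow>
     u \<in> L2_controls \<and> caratheodory_solution (plant f g) {0..} z0 u z \<and>
     (\<lambda>t. running_cost h Q R (z t) (u t)) absolutely_integrable_on {0..}"

definition admissible_controls ::
  "(real^'n \<Rightarrow> real^'n) \<Rightarrow> (real^'n \<Rightarrow> real^'m^'n) \<Rightarrow> (real^'n \<Rightarrow> real^'m) \<Rightarrow>
   real^'m^'m \<Rightarrow> real^'m^'m \<Rightarrow> real^'n \<Rightarrow> (real \<Rightarrow> real^'m) set" where
  "admissible_controls f g h Q R z0 = {u. \<exists>z. admissible_pair f g h Q R z0 u z}"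

definition value_function ::
  "(real^'n \<Rightarrow> real^'n) \<Rightarrow> (real^'n \<Rightarrow> real^'m^'n) \<Rightarrow> (real^'n \<Rightarrow> real^'m) \<Rightarrow>
   real^'m^'m \<Rightarrow> real^'m^'m \<Rightarrow> real^'n \<Rightarrow> real" where
  "value_function f g h Q R z0 = Inf {total_cost h Q R u z |u z. admissible_pair f g h Q R z0 u z}"

text \<open>A feedback law \<open>k\<close> is optimal if, from every initial state, it generates along some
  solution of the closed loop a control that attains the infimum.\<close>

definition optimal_feedback ::
  "(real^'n \<Rightarrow> real^'n) \<Rightarrow> (real^'n \<Rightarrow> real^'m^'n) \<Rightarrow> (real^'n \<Rightarrow> real^'m) \<Rightarrow>
   real^'m^'m \<Rightarrow> real^'m^'m \<Rightarrow> (real^'n \<Rightarrow> real^'m) \<Rightarrow> bool" where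
  "optimal_feedback f g h Q R k \<longleftrightarrow>
     (\<forall>z0. \<exists>z. admissible_pair f g h Q R z0 (\<lambda>t. k (z t)) z \<and>
               total_cost h Q R (\<lambda>t. k (z t)) z = value_function f g h Q R z0)"

text \<open>Passivity of $\dot z = F(z,u)$, $y = k(z)$ with storage function \<open>H\<close>. The control and the
  solution are only required on $[0,t_1]$, which covers restrictions of global solutions as well
  as solutions with finite escape time. Controls need only be integrable on that interval, so in particular
  those in $L^2$ are allowed. The supply rate is required to be integrable so that the integral
  on the right-hand side is meaningful.\<close>

definition passive_with_storage ::
  "('z::euclidean_space \<Rightarrow> 'u::euclidean_space \<Rightarrow> 'z) \<Rightarrow> ('z \<Rightarrow> 'u) \<Rightarrow> ('z \<Rightarrow> real) \<Rightarrow> bool" where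
  "passive_with_storage F k H \<longleftrightarrow>
     (\<forall>z. 0 \<le> H z) \<and>
     (\<forall>z0 u z t0 t1. 0 \<le> t0 \<longrightarrow> t0 \<le> t1 \<longrightarrow> u absolutely_integrable_on {0..t1} \<longrightarrow>
        caratheodory_solution F {0..t1} z0 u z \<longrightarrow>
        (\<lambda>t. k (z t) \<bullet> u t) absolutely_integrable_on {t0..t1} \<and>
        H (z t1) - H (z t0) \<le> integral {t0..t1} (\<lambda>t. k (z t) \<bullet> u t))"

end

theory Submission
  imports Defs
begin

text \<open>Comparing the optimal trajectory from \<open>z0\<close> with its own tails, which are admissible, gives
  $\hat H(z(T)) - \hat H(z_0) \<le> -\frac12 \int_0^T (y^T Q y + u^T R u)$. Letting $T \to 0$ yields one
  half of the Hamilton--Jacobi--Bellman equation,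
  $\nabla\hat H \cdot f - |\hat y|^2 \<le> -\frac12 (|Q^{1/2} h|^2 + |\hat y|^2)$. Hence along the new
  system $\frac{d}{dt} \hat H \<le> \hat y \cdot \hat u - \frac12 |\hat y + Q^{1/2} h|^2$, which is
  integrated using a chain rule for absolutely continuous curves.\<close>

subsection \<open>Square roots of positive semidefinite matrices\<close>

text \<open>Optimality is known only along some solution from each initial state, and solutions may
  fail to be unique, so trajectories of the plant and of the new system are never compared. The
  Hamilton--Jacobi--Bellman inequality concerns a single state instead, and so applies along every
  solution of the new system, whatever its input. The limit T -> 0 exists pointwise because the
  optimal control is a continuous feedback: along the closed loop both the rate of the value
  function and the running cost are continuous in time, whereas a general control is only
  measurable.

  The square closes because the damping term (the gradient paired with g R^{-1} g^T times itself)
  and the control cost of the feedback are the same number |y|^2. The running cost carries the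
  factor 1/2, so -|y|^2/2 remains, which is what the cross term -y . Q^{1/2} h requires.\<close>

lemma inner_matrix_vector_transpose:
  fixes A :: "real^'n^'m"
  shows "x \<bullet> (A *v y) = (transpose A *v x) \<bullet> y"
  by (metis dot_lmul_matrix transpose_matrix_vector)

lemma sym_pos_semidef_inner_swap:
  "sym_pos_semidef A \<Longrightarrow> x \<bullet> (A *v y) = (A *v x) \<bullet> y"
  by (metis inner_matrix_vector_transpose sym_pos_semidef_def)

text \<open>A Cauchy--Schwarz type estimate in which \<open>c\<close> bounds the operator norm of
  \<open>A\<close>. It serves twice: vectors on which the form vanishes lie in the kernel, and I -
  A/c is a contraction.\<close>

lemma sym_pos_semidef_norm_bound:
  fixes A :: "real^'k^'k"
  assumes A: "sym_pos_semidef A"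
  obtains c where "c > 0" "\<And>x. (norm (A *v x))\<^sup>2 \<le> c * (x \<bullet> (A *v x))"
proof -
  obtain c where c: "c > 0" "\<And>x. norm (A *v x) \<le> norm x * c"
    using bounded_linear.pos_bounded[OF matrix_vector_mul_bounded_linear[of A]] by metis
  have "(norm (A *v x))\<^sup>2 \<le> c * (x \<bullet> (A *v x))" for x
  proof -
    define a where "a = A *v x"
    \<comment> \<open>The form at x - t a is at most x . a - (2 t - c t^2) |a|^2, which is smallest
      at t = 1/c.\<close>
    define y where "y = x - (1 / c) *\<^sub>R a"
    have "a \<bullet> (A *v a) \<le> norm a * norm (A *v a)"
      by (rule norm_cauchy_schwarz)
    also have "\<dots> \<le> norm a * (norm a * c)"
      using c by (intro mult_left_mono) auto
    finally have 1: "a \<bullet> (A *v a) \<le> c * (norm a)\<^sup>2"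
      by (simp add: power2_eq_square mult_ac)
    have "0 \<le> y \<bullet> (A *v y)"
      using A by (simp add: sym_pos_semidef_def)
    also have "y \<bullet> (A *v y) = x \<bullet> a - (2 / c) * (norm a)\<^sup>2 + (1 / c\<^sup>2) * (a \<bullet> (A *v a))"
      using sym_pos_semidef_inner_swap[OF A, of x a]
      by (simp add: y_def matrix_vector_mult_diff_distrib matrix_vector_mult_scaleR
          inner_diff_left inner_diff_right a_def[symmetric] power2_norm_eq_inner
          power2_eq_square[of c] algebra_simps)
    also have "\<dots> \<le> x \<bullet> a - (2 / c) * (norm a)\<^sup>2 + (1 / c\<^sup>2) * (c * (norm a)\<^sup>2)"
      using 1 by (intro add_left_mono mult_left_mono) auto
    also have "\<dots> = x \<bullet> a - (1 / c) * (norm a)\<^sup>2"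
      using c(1) by (simp add: field_simps power2_eq_square)
    finally show ?thesis
      using c(1) by (simp add: a_def field_simps)
  qed
  with c(1) show thesis by (rule that)
qed

lemma sym_pos_semidef_null:
  fixes A :: "real^'k^'k"
  assumes "sym_pos_semidef A" "x \<bullet> (A *v x) = 0"
  shows "A *v x = 0"
proof -
  obtain c where "\<And>x. (norm (A *v x))\<^sup>2 \<le> c * (x \<bullet> (A *v x))"
    using sym_pos_semidef_norm_bound[OF assms(1)] by metis
  from this[of x] assms(2) show ?thesis by simp
qed

lemma uminus_matrix_vector_mult:
  fixes A :: "real^'n^'m"
  shows "(- A) *v x = - (A *v x)"
  using matrix_vector_mult_diff_rdistrib[of 0 A x] by simp

lemma matrix_add_rdistrib:
  fixes A B :: "real^'n^'m"
  shows "(A + B) ** C = A ** C + B ** C"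
  by (simp add: matrix_eq matrix_vector_mul_assoc[symmetric] matrix_vector_mult_add_rdistrib)

lemma bounded_bilinear_matrix_matrix_mult:
  "bounded_bilinear ((**) :: real^'n^'m \<Rightarrow> real^'k^'n \<Rightarrow> real^'k^'m)"
  by (intro bilinear_conv_bounded_bilinear[THEN iffD1])
     (auto simp: bilinear_def matrix_add_ldistrib matrix_add_rdistrib matrix_scalar_ac
        scalar_matrix_assoc intro!: linearI)

text \<open>For symmetric D this turns the trace of D M D into a sum of values of the quadratic form
  of M, so that semidefiniteness of M gives its sign.\<close>

lemma trace_eq_sum_axis: "trace A = (\<Sum>i\<in>UNIV. axis i 1 \<bullet> (A *v axis i (1::real)))"
  unfolding trace_def
  by (intro sum.cong refl) (simp add: inner_axis' matrix_vector_mul_component inner_axis)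

text \<open>Brouwer's theorem replaces the spectral theorem: a fixed point \<open>Y\<close> of
  $Y \<mapsto> (B + Y^2)/2$ on the symmetric contractions satisfies $(I - Y)^2 = I - B$.\<close>

lemma sym_pos_semidef_root_exists:
  fixes A :: "real^'k^'k"
  assumes A: "sym_pos_semidef A"
  shows "\<exists>S. sym_pos_semidef S \<and> S ** S = A"
proof -
  obtain c where c: "c > 0" "\<And>x. (norm (A *v x))\<^sup>2 \<le> c * (x \<bullet> (A *v x))"
    using sym_pos_semidef_norm_bound[OF A] by metis
  \<comment> \<open>Dividing by \<open>c\<close> rescales \<open>A\<close> so that I - A/c does not
    increase norms; the root of A/c is then sought in the form I - Y.\<close>
  define B where "B = mat 1 - (1 / c) *\<^sub>R A"
  have Bv: "B *v x = x - (1 / c) *\<^sub>R (A *v x)" for x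
    by (simp add: B_def matrix_vector_mult_diff_rdistrib scaleR_matrix_vector_assoc[symmetric])
  have Bsym: "transpose B = B"
    using A by (simp add: B_def sym_pos_semidef_def transpose_def vec_eq_iff mat_def)
  have Bnorm: "norm (B *v x) \<le> norm x" for x
  proof (rule power2_le_imp_le)
    have "(norm (B *v x))\<^sup>2
        = (norm x)\<^sup>2 - (2 / c) * (x \<bullet> (A *v x)) + (1 / c\<^sup>2) * (norm (A *v x))\<^sup>2"
      unfolding Bv power2_norm_eq_inner
      by (simp add: inner_diff_left inner_diff_right inner_commute power2_eq_square algebra_simps)
    also have "\<dots> \<le> (norm x)\<^sup>2 - (2 / c) * (x \<bullet> (A *v x)) + (1 / c\<^sup>2) * (c * (x \<bullet> (A *v x)))"
      using c by (intro add_left_mono mult_left_mono) auto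
    also have "\<dots> = (norm x)\<^sup>2 - (1 / c) * (x \<bullet> (A *v x))"
      using c(1) by (simp add: field_simps power2_eq_square)
    also have "\<dots> \<le> (norm x)\<^sup>2"
      using A c(1) by (simp add: sym_pos_semidef_def)
    finally show "(norm (B *v x))\<^sup>2 \<le> (norm x)\<^sup>2" .
  qed simp
  \<comment> \<open>Bounding norms instead of prescribing eigenvalues makes \<open>K\<close> visibly
    closed, convex and stable under squaring, and it contains \<open>B\<close>.\<close>
  define K :: "(real^'k^'k) set" where
    "K = {Y. transpose Y = Y \<and> (\<forall>x. norm (Y *v x) \<le> norm x)}"
  define \<Phi> :: "real^'k^'k \<Rightarrow> real^'k^'k" where "\<Phi> Y = (1/2) *\<^sub>R (B + Y ** Y)" for Y
  have cont_mult: "continuous_on T (\<lambda>Y. Y ** Y)" for T :: "(real^'k^'k) set"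
    by (intro bounded_bilinear.continuous_on[OF bounded_bilinear_matrix_matrix_mult]
        continuous_on_id)
  have lin_vec: "bounded_linear (\<lambda>Y :: real^'k^'k. Y *v x)" for x
    by (rule linear_conv_bounded_linear[THEN iffD1])
       (auto intro!: linearI simp: matrix_vector_mult_add_rdistrib scaleR_matrix_vector_assoc)
  have lin_tr: "bounded_linear (transpose :: real^'k^'k \<Rightarrow> _)"
    by (rule linear_conv_bounded_linear[THEN iffD1])
       (auto intro!: linearI simp: transpose_def vec_eq_iff)
  have "closed K"
  proof -
    have "K = {Y. transpose Y = Y} \<inter> (\<Inter>x. {Y. norm (Y *v x) \<le> norm x})"
      by (auto simp: K_def)
    moreover have "closed {Y :: real^'k^'k. transpose Y = Y}"
      by (intro closed_Collect_eq bounded_linear.continuous_on[OF lin_tr] continuous_on_id)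
    moreover have "closed {Y :: real^'k^'k. norm (Y *v x) \<le> norm x}" for x
      by (intro closed_Collect_le continuous_on_norm bounded_linear.continuous_on[OF lin_vec]
          continuous_on_id continuous_on_const)
    ultimately show ?thesis by auto
  qed
  moreover have "bounded K"
  proof -
    have "norm Y \<le> real CARD('k) * real CARD('k)" if "Y \<in> K" for Y
    proof -
      have "\<bar>Y $ i $ j\<bar> \<le> 1" for i j
      proof -
        have "\<bar>Y $ i $ j\<bar> = \<bar>(Y *v axis j 1) $ i\<bar>"
          by (simp add: matrix_vector_mul_component inner_axis)
        also have "\<dots> \<le> norm (Y *v axis j 1)" by (rule component_le_norm_cart)
        also have "\<dots> \<le> norm (axis j 1 :: real^'k)"
          using that unfolding K_def by blast
        finally show ?thesis by (simp add: norm_axis_1)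
      qed
      then have "norm (Y $ i) \<le> real CARD('k)" for i
        using norm_le_l1_cart[of "Y $ i"] sum_bounded_above[of UNIV "\<lambda>j. \<bar>Y $ i $ j\<bar>" 1]
        by force
      then have "(\<Sum>i\<in>UNIV. norm (Y $ i)) \<le> real CARD('k) * real CARD('k)"
        using sum_bounded_above[of UNIV "\<lambda>i. norm (Y $ i)" "real CARD('k)"] by force
      moreover have "norm Y \<le> (\<Sum>i\<in>UNIV. norm (Y $ i))"
        unfolding norm_vec_def by (rule L2_set_le_sum) simp
      ultimately show ?thesis by linarith
    qed
    then show ?thesis by (auto simp: bounded_iff)
  qed
  ultimately have "compact K" by (simp add: compact_eq_bounded_closed)
  moreover have "convex K"
  proof (rule convexI)
    fix X Y and u v :: real
    assume XY: "X \<in> K" "Y \<in> K" and uv: "0 \<le> u" "0 \<le> v" "u + v = 1"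
    have "norm ((u *\<^sub>R X + v *\<^sub>R Y) *v x) \<le> norm x" for x
    proof -
      have "norm ((u *\<^sub>R X + v *\<^sub>R Y) *v x) \<le> norm (u *\<^sub>R (X *v x)) + norm (v *\<^sub>R (Y *v x))"
        unfolding matrix_vector_mult_add_rdistrib scaleR_matrix_vector_assoc[symmetric]
        by (rule norm_triangle_ineq)
      also have "\<dots> \<le> u * norm x + v * norm x"
        using XY uv by (auto simp: K_def intro!: add_mono mult_left_mono)
      also have "\<dots> = norm x" using uv by (metis distrib_right mult_1)
      finally show ?thesis .
    qed
    moreover have "transpose (u *\<^sub>R X + v *\<^sub>R Y) = u *\<^sub>R X + v *\<^sub>R Y"
      using XY by (auto simp: K_def transpose_def vec_eq_iff)
    ultimately show "u *\<^sub>R X + v *\<^sub>R Y \<in> K" by (simp add: K_def)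
  qed
  moreover have "K \<noteq> {}"
    using Bsym Bnorm by (auto simp: K_def)
  moreover have "continuous_on K \<Phi>"
    unfolding \<Phi>_def by (intro continuous_intros cont_mult)
  moreover have "\<Phi> \<in> K \<rightarrow> K"
  proof
    fix Y assume Y: "Y \<in> K"
    have "norm (\<Phi> Y *v x) \<le> norm x" for x
    proof -
      have "norm (\<Phi> Y *v x) = norm (B *v x + Y *v (Y *v x)) / 2"
        by (simp add: \<Phi>_def matrix_vector_mult_add_rdistrib scaleR_matrix_vector_assoc[symmetric]
            matrix_vector_mul_assoc)
      also have "\<dots> \<le> (norm (B *v x) + norm (Y *v (Y *v x))) / 2"
        by (intro divide_right_mono norm_triangle_ineq) auto
      also have "\<dots> \<le> norm x"
        using Bnorm[of x] Y order_trans[of "norm (Y *v (Y *v x))" "norm (Y *v x)" "norm x"]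
        by (auto simp: K_def)
      finally show ?thesis .
    qed
    moreover have "transpose (\<Phi> Y) = \<Phi> Y"
    proof -
      have "transpose (Y ** Y) = Y ** Y" using Y by (simp add: K_def matrix_transpose_mul)
      with Bsym show ?thesis by (simp add: \<Phi>_def transpose_def vec_eq_iff)
    qed
    ultimately show "\<Phi> Y \<in> K" by (simp add: K_def)
  qed
  ultimately obtain Y where Y: "Y \<in> K" "\<Phi> Y = Y"
    by (rule brouwer)
  \<comment> \<open>The fixed point equation reads (I - Y)^2 = I - B = A/c, which explains the
    factor \<open>sqrt c\<close>. Semidefiniteness follows since \<open>Y\<close> is a
    contraction.\<close>
  define S where "S = sqrt c *\<^sub>R (mat 1 - Y)"
  have Sv: "S *v x = sqrt c *\<^sub>R (x - Y *v x)" for x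
    by (simp add: S_def matrix_vector_mult_diff_rdistrib scaleR_matrix_vector_assoc[symmetric])
  have "sym_pos_semidef S"
    unfolding sym_pos_semidef_def
  proof (intro conjI allI)
    show "transpose S = S"
      using Y(1) by (simp add: S_def K_def transpose_def vec_eq_iff mat_def)
    fix x
    have "x \<bullet> (Y *v x) \<le> norm x * norm (Y *v x)" by (rule norm_cauchy_schwarz)
    also have "\<dots> \<le> norm x * norm x"
      using Y(1) by (intro mult_left_mono) (auto simp: K_def)
    finally have "0 \<le> x \<bullet> (x - Y *v x)"
      by (simp add: inner_diff_right power2_norm_eq_inner[symmetric] power2_eq_square)
    then show "0 \<le> x \<bullet> (S *v x)" using c(1) by (simp add: Sv)
  qed
  moreover have "S ** S = A"
  proof (rule matrix_eq[THEN iffD2], intro allI)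
    fix x
    have "2 *\<^sub>R (\<Phi> Y *v x) = B *v x + Y *v (Y *v x)"
      by (simp add: \<Phi>_def matrix_vector_mult_add_rdistrib scaleR_matrix_vector_assoc[symmetric]
            matrix_vector_mul_assoc)
    then have fp: "Y *v (Y *v x) = 2 *\<^sub>R (Y *v x) - x + (1 / c) *\<^sub>R (A *v x)"
      by (simp add: Y(2) Bv algebra_simps)
    have "S ** S *v x = c *\<^sub>R (x - 2 *\<^sub>R (Y *v x) + Y *v (Y *v x))"
      using c(1) by (simp add: matrix_vector_mul_assoc[symmetric] Sv matrix_vector_mult_scaleR
          matrix_vector_mult_diff_distrib scaleR_2 algebra_simps)
    also have "\<dots> = A *v x" using c(1) by (simp add: fp)
    finally show "S ** S *v x = A *v x" .
  qed
  ultimately show ?thesis by blast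
qed

text \<open>With D = S - T, equality of the squares gives D S = -T D, so the traces of D S D and D T
  D are opposite. Both are nonnegative, hence zero, and then S and T annihilate the range of
  D.\<close>

lemma sym_pos_semidef_root_unique:
  fixes S T :: "real^'k^'k"
  assumes S: "sym_pos_semidef S" and T: "sym_pos_semidef T" and eq: "S ** S = T ** T"
  shows "S = T"
proof -
  define D where "D = S - T"
  have Dv: "D *v x = S *v x - T *v x" for x
    by (simp add: D_def matrix_vector_mult_diff_rdistrib)
  have Dswap: "x \<bullet> (D *v y) = (D *v x) \<bullet> y" for x y
    by (simp add: Dv inner_diff_left inner_diff_right sym_pos_semidef_inner_swap[OF S]
        sym_pos_semidef_inner_swap[OF T])
  have DS: "D ** S = - (T ** D)"
  proof (rule matrix_eq[THEN iffD2], intro allI)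
    fix x
    have "S *v (S *v x) = T *v (T *v x)" by (simp add: matrix_vector_mul_assoc eq)
    then show "D ** S *v x = - (T ** D) *v x"
      by (simp add: uminus_matrix_vector_mult matrix_vector_mul_assoc[symmetric] Dv
          matrix_vector_mult_diff_distrib)
  qed
  have tr: "trace (D ** M ** D) = (\<Sum>i\<in>UNIV. (D *v axis i 1) \<bullet> (M *v (D *v axis i 1)))" for M
    unfolding trace_eq_sum_axis
    by (intro sum.cong refl) (simp add: matrix_vector_mul_assoc[symmetric] Dswap)
  \<comment> \<open>Cyclicity brings \<open>D ** S\<close> together, so that the anticommutation
    relation \<open>DS\<close> can be applied.\<close>
  have "trace (D ** S ** D) = trace (D ** (D ** S))" by (rule trace_mul_sym)
  also have "\<dots> = trace (0 - D ** T ** D)"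
  proof -
    have "D *v (- (T *v (D *v x))) = - (D *v (T *v (D *v x)))" for x
      using matrix_vector_mult_diff_distrib[of D 0] by simp
    then have "D ** (- (T ** D)) = 0 - D ** T ** D"
      by (simp add: matrix_eq uminus_matrix_vector_mult matrix_vector_mul_assoc[symmetric])
    then show ?thesis by (simp add: DS)
  qed
  also have "\<dots> = - trace (D ** T ** D)" by (simp add: trace_def sum_negf)
  finally have "(\<Sum>i\<in>UNIV. (D *v axis i 1) \<bullet> (S *v (D *v axis i 1))
      + (D *v axis i 1) \<bullet> (T *v (D *v axis i 1))) = 0"
    by (simp add: tr sum.distrib)
  moreover have nn: "0 \<le> x \<bullet> (S *v x)" "0 \<le> x \<bullet> (T *v x)" for x
    using S T by (auto simp: sym_pos_semidef_def)
  ultimately have z: "(D *v axis i 1) \<bullet> (S *v (D *v axis i 1))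
      + (D *v axis i 1) \<bullet> (T *v (D *v axis i 1)) = 0" for i
    by (subst (asm) sum_nonneg_eq_0_iff) auto
  have "D *v axis i 1 = 0" for i
  proof -
    let ?u = "D *v axis i 1"
    have "?u \<bullet> (S *v ?u) = 0" "?u \<bullet> (T *v ?u) = 0" using z[of i] nn[of ?u] by linarith+
    \<comment> \<open>Both forms vanish at \<open>?u\<close>, so S and T map it to 0. Thus D^2
      vanishes on the axis vector, and the symmetry of D turns this into
      \<open>?u \<bullet> ?u = 0\<close>.\<close>
    then have "D *v ?u = 0"
      using S T by (simp add: Dv sym_pos_semidef_null)
    then have "?u \<bullet> ?u = 0" by (metis Dswap inner_zero_right)
    then show ?thesis by simp
  qed
  then have "D $ j $ i = 0" for i j
    by (metis inner_axis inner_real_def matrix_vector_mul_component mult.right_neutral zero_index)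
  then have "D = 0" by (simp add: vec_eq_iff)
  then show ?thesis by (simp add: D_def)
qed

lemma matrix_sqrt:
  fixes A :: "real^'k^'k"
  assumes "sym_pos_semidef A"
  shows sym_pos_semidef_matrix_sqrt: "sym_pos_semidef (matrix_sqrt A)"
    and matrix_sqrt_square: "matrix_sqrt A ** matrix_sqrt A = A"
proof -
  have "\<exists>!S. sym_pos_semidef S \<and> S ** S = A"
    using sym_pos_semidef_root_exists[OF assms] sym_pos_semidef_root_unique
    by (metis (no_types, lifting))
  from theI'[OF this] show "sym_pos_semidef (matrix_sqrt A)" "matrix_sqrt A ** matrix_sqrt A = A"
    by (auto simp: matrix_sqrt_def)
qed

section \<open>Inverse of the root of a positive definite matrix\<close>

lemma matrix_inv_right_left:
  fixes A :: "real^'k^'k"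
  assumes "invertible A"
  shows "A ** matrix_inv A = mat 1" "matrix_inv A ** A = mat 1"
  using someI_ex[OF assms[unfolded invertible_def]] by (simp_all add: matrix_inv_def)

lemma invertible_matrix_sqrt:
  fixes R :: "real^'k^'k"
  assumes "sym_pos_semidef R" "invertible R"
  shows "invertible (matrix_sqrt R)"
proof -
  let ?S = "matrix_sqrt R"
  have "?S ** (?S ** matrix_inv R) = mat 1"
    by (simp add: matrix_mul_assoc matrix_sqrt_square assms matrix_inv_right_left)
  then show ?thesis by (auto simp: invertible_right_inverse)
qed

text \<open>The matrix R^{-1/2} is encoded as the inverse of the root, not as the root of the
  inverse. Its square and its symmetry are therefore derived by cancelling factors of the
  root.\<close>

lemma matrix_inv_sqrt_square:
  fixes R :: "real^'k^'k"
  assumes R: "sym_pos_semidef R" "invertible R"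
  shows "matrix_inv (matrix_sqrt R) *v (matrix_inv (matrix_sqrt R) *v x) = matrix_inv R *v x"
proof -
  let ?S = "matrix_sqrt R" let ?V = "matrix_inv ?S"
  note V = matrix_inv_right_left[OF invertible_matrix_sqrt[OF R]]
  have "?V *v (?V *v (R *v y)) = y" for y
  proof -
    have "R *v y = ?S *v (?S *v y)"
      by (simp add: matrix_vector_mul_assoc matrix_sqrt_square R)
    moreover have "?V *v (?S *v w) = w" for w
      by (simp add: matrix_vector_mul_assoc V)
    ultimately show ?thesis by simp
  qed
  from this[of "matrix_inv R *v x"] show ?thesis
    using matrix_inv_right_left(1)[OF R(2)] by (simp add: matrix_vector_mul_assoc)
qed

lemma matrix_inv_sqrt_inner_swap:
  fixes R :: "real^'k^'k"
  assumes R: "sym_pos_semidef R" "invertible R"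
  shows "x \<bullet> (matrix_inv (matrix_sqrt R) *v y) = (matrix_inv (matrix_sqrt R) *v x) \<bullet> y"
proof -
  let ?S = "matrix_sqrt R" let ?V = "matrix_inv ?S"
  have SV: "?S *v (?V *v w) = w" for w
    using matrix_inv_right_left[OF invertible_matrix_sqrt[OF R]]
    by (simp add: matrix_vector_mul_assoc)
  have "x \<bullet> (?V *v y) = (?S *v (?V *v x)) \<bullet> (?V *v y)" by (simp add: SV)
  also have "\<dots> = (?V *v x) \<bullet> (?S *v (?V *v y))"
    by (simp add: sym_pos_semidef_inner_swap[OF sym_pos_semidef_matrix_sqrt[OF R(1)]])
  finally show ?thesis by (simp add: SV)
qed

subsection \<open>Chain rule along Caratheodory solutions\<close>

text \<open>Existence and uniqueness of the representing vector give the definite description in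
  \<open>gradient\<close> its value.\<close>

lemma gderiv_gradient:
  fixes H :: "'z::euclidean_space \<Rightarrow> real"
  assumes "H differentiable (at z)"
  shows "GDERIV H z :> gradient H z"
proof -
  obtain H' where H': "(H has_derivative H') (at z)"
    using assms by (auto simp: differentiable_def)
  interpret bounded_linear H' by (rule has_derivative_bounded_linear[OF H'])
  \<comment> \<open>Riesz representation: the vector representing a functional is its adjoint
    applied to 1.\<close>
  have "H' = inner (adjoint H' 1)"
    by (rule ext) (metis adjoint_works inner_commute inner_real_def linear_axioms mult.right_neutral)
  then have "\<exists>D. GDERIV H z :> D"
    using H' by (metis ext gderiv_def inner_commute)
  moreover have "D = E" if "GDERIV H z :> D" "GDERIV H z :> E" for D E
  proof -
    have "(\<lambda>x. x \<bullet> D) = (\<lambda>x. x \<bullet> E)"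
      using that unfolding gderiv_def by (rule has_derivative_unique)
    then show ?thesis by (metis vector_eq_ldot)
  qed
  ultimately show ?thesis
    unfolding gradient_def by (metis theI)
qed

lemma caratheodory_solution_increment:
  assumes sol: "caratheodory_solution F I z0 u z" and b: "b \<in> I" "0 \<le> a" "a \<le> b" "a \<in> I"
  shows "z b - z a = integral {a..b} (\<lambda>s. F (z s) (u s))"
proof -
  have "(\<lambda>s. F (z s) (u s)) integrable_on {0..b}"
    using sol b by (auto simp: caratheodory_solution_def set_lebesgue_integral_eq_integral)
  from Henstock_Kurzweil_Integration.integral_combine[OF b(2,3) this]
  show ?thesis
    using sol b by (auto simp: caratheodory_solution_def algebra_simps)
qed

lemma caratheodory_solution_initial:
  "caratheodory_solution F I z0 u z \<Longrightarrow> 0 \<in> I \<Longrightarrow> z 0 = z0"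
  by (auto simp: caratheodory_solution_def)

lemma caratheodory_solution_continuous:
  assumes sol: "caratheodory_solution F {0..T} z0 u z"
  shows "continuous_on {0..T} z"
proof (cases "0 \<le> T")
  case True
  then have "(\<lambda>s. F (z s) (u s)) integrable_on {0..T}"
    using sol by (auto simp: caratheodory_solution_def set_lebesgue_integral_eq_integral)
  then have "continuous_on {0..T} (\<lambda>t. z0 + integral {0..t} (\<lambda>s. F (z s) (u s)))"
    by (intro continuous_intros indefinite_integral_continuous_1)
  moreover have "z t = z0 + integral {0..t} (\<lambda>s. F (z s) (u s))" if "t \<in> {0..T}" for t
    using sol that unfolding caratheodory_solution_def by blast
  ultimately show ?thesis by (metis (no_types, lifting) continuous_on_cong)
qed auto

text \<open>A continuous factor is bounded on the compact interval. This covers both the rate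
  (gradient against velocity) and the supply (output against input).\<close>

lemma absolutely_integrable_continuous_inner:
  fixes p w :: "real \<Rightarrow> 'a::euclidean_space"
  assumes p: "continuous_on {a..b} p" and w: "w absolutely_integrable_on {a..b}"
  shows "(\<lambda>s. p s \<bullet> w s) absolutely_integrable_on {a..b}"
proof (rule absolutely_integrable_bounded_measurable_product[where h = inner])
  show "bilinear (inner :: 'a \<Rightarrow> 'a \<Rightarrow> real)"
    by (simp add: bilinear_conv_bounded_bilinear bounded_bilinear_inner)
  show "p \<in> borel_measurable (lebesgue_on {a..b})"
    by (rule continuous_imp_measurable_on_sets_lebesgue[OF p]) simp
  show "bounded (p ` {a..b})"
    by (intro compact_imp_bounded compact_continuous_image p compact_Icc)
qed (use w in auto)

text \<open>\<open>z\<close> need not be differentiable where \<open>w\<close> is discontinuous, so the estimate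
  $|H(z(b)) - H(z(a)) - \int_a^b \nabla H(z) \cdot w| \<le> \epsilon \int_a^b |w|$ is shown for short
  intervals and extended to all intervals by additivity of both sides.\<close>

lemma chain_rule_indefinite_integral:
  fixes H :: "'z::euclidean_space \<Rightarrow> real" and z w :: "real \<Rightarrow> 'z"
  assumes H: "continuously_differentiable H"
    and z: "continuous_on {a..b} z" and w: "w absolutely_integrable_on {a..b}" and ab: "a \<le> b"
    and incr: "\<And>c d. a \<le> c \<Longrightarrow> c \<le> d \<Longrightarrow> d \<le> b \<Longrightarrow> z d - z c = integral {c..d} w"
  shows "H (z b) - H (z a) = integral {a..b} (\<lambda>s. gradient H (z s) \<bullet> w s)"
proof -
  have gd: "(H has_derivative (\<lambda>x. x \<bullet> gradient H y)) (at y within S)" for y S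
    using H gderiv_gradient[of H y] unfolding continuously_differentiable_def gderiv_def
    by (auto intro: has_derivative_at_withinI)
  have gc: "continuous_on UNIV (gradient H)"
    using H by (simp add: continuously_differentiable_def)
  let ?G = "\<lambda>s. gradient H (z s) \<bullet> w s"
  have pc: "continuous_on {a..b} (\<lambda>s. gradient H (z s))"
    using continuous_on_compose2[OF gc z] by simp
  have G: "?G absolutely_integrable_on {a..b}"
    by (rule absolutely_integrable_continuous_inner[OF pc w])
  have sub: "v absolutely_integrable_on {c..d} \<Longrightarrow> c \<le> c' \<Longrightarrow> d' \<le> d \<Longrightarrow> v integrable_on {c'..d'}"
    for v :: "real \<Rightarrow> 'y::euclidean_space" and c d c' d'
    using absolutely_integrable_on_subinterval[where f = v and S = "{c..d}" and a = c' and b = d']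
    by (auto simp: absolutely_integrable_on_def)
  have nw: "(\<lambda>s. norm (w s)) absolutely_integrable_on {a..b}"
    using w by (simp add: absolutely_integrable_on_def)
  define m where "m = integral {a..b} (\<lambda>s. norm (w s))"
  have est: "\<bar>H (z b) - H (z a) - integral {a..b} ?G\<bar> \<le> e * m" if e: "e > 0" for e
  proof -
    \<comment> \<open>Bolzano's bisection principle tests all short intervals around a point,
      including those that leave [a,b]; the two premises make \<open>P\<close> vacuous
      there.\<close>
    define P where "P c d \<longleftrightarrow> (a \<le> c \<longrightarrow> d \<le> b \<longrightarrow>
       \<bar>H (z d) - H (z c) - integral {c..d} ?G\<bar> \<le> e * integral {c..d} (\<lambda>s. norm (w s)))" for c d
    have "P a b"
      using ab
    proof (induction rule: Bolzano)
      case (trans p q r)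
      show ?case unfolding P_def
      proof (intro impI)
        assume pr: "a \<le> p" "r \<le> b"
        have 1: "integral {p..r} ?G = integral {p..q} ?G + integral {q..r} ?G"
          using trans pr
          by (intro Henstock_Kurzweil_Integration.integral_combine[symmetric] sub[OF G])
        have 2: "integral {p..r} (\<lambda>s. norm (w s))
            = integral {p..q} (\<lambda>s. norm (w s)) + integral {q..r} (\<lambda>s. norm (w s))"
          using trans pr
          by (intro Henstock_Kurzweil_Integration.integral_combine[symmetric] sub[OF nw])
        have "\<bar>H (z q) - H (z p) - integral {p..q} ?G\<bar> \<le> e * integral {p..q} (\<lambda>s. norm (w s))"
          "\<bar>H (z r) - H (z q) - integral {q..r} ?G\<bar> \<le> e * integral {q..r} (\<lambda>s. norm (w s))"
          using trans pr by (auto simp: P_def)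
        then show "\<bar>H (z r) - H (z p) - integral {p..r} ?G\<bar>
            \<le> e * integral {p..r} (\<lambda>s. norm (w s))"
          unfolding 1 2 distrib_left by linarith
      qed
    next
      case (local x)
      let ?D = "gradient H (z x)"
      \<comment> \<open>One half of \<open>e\<close> pays for linearizing \<open>H\<close> between
        the end points, the other for freezing the gradient under the integral.\<close>
      obtain \<eta> where \<eta>: "\<eta> > 0" "\<And>y. dist y (z x) < \<eta> \<Longrightarrow> dist (gradient H y) ?D < e / 2"
        using gc e unfolding continuous_on_iff by (metis UNIV_I half_gt_zero)
      obtain \<delta> where \<delta>: "\<delta> > 0" "\<And>s. s \<in> {a..b} \<Longrightarrow> dist s x < \<delta> \<Longrightarrow> dist (z s) (z x) < \<eta>"
        using z \<eta>(1) local unfolding continuous_on_iff by (metis atLeastAtMost_iff)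
      have "P c d" if cd: "c \<le> x" "x \<le> d" "d - c < \<delta>" for c d
        unfolding P_def
      proof (intro impI)
        assume ac: "a \<le> c" "d \<le> b"
        have near: "dist (z s) (z x) < \<eta>" if "s \<in> {c..d}" for s
          using that cd ac by (intro \<delta>(2)) (auto simp: dist_real_def)
        define N where "N = integral {c..d} (\<lambda>s. norm (w s))"
        have wi: "w integrable_on {c..d}" and nwi: "(\<lambda>s. norm (w s)) integrable_on {c..d}"
          and Gi: "?G integrable_on {c..d}"
          using ac by (auto intro: sub[OF w] sub[OF nw] sub[OF G])
        have zd: "z d - z c = integral {c..d} w" using incr ac cd by force
        have zN: "norm (z d - z c) \<le> N"
          unfolding zd N_def by (rule integral_norm_bound_integral[OF wi nwi]) simp
        \<comment> \<open>Mean value inequality on a ball, which is convex, for \<open>H\<close>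
          minus its linear part at \<open>z x\<close>; the derivative of this difference has norm at
          most e/2.\<close>
        have "norm ((\<lambda>y. H y - y \<bullet> ?D) (z d) - (\<lambda>y. H y - y \<bullet> ?D) (z c))
            \<le> (e / 2) * norm (z d - z c)"
        proof (rule differentiable_bound[where S = "ball (z x) \<eta>"
                and f' = "\<lambda>y v. v \<bullet> gradient H y - v \<bullet> ?D"])
          fix y assume y: "y \<in> ball (z x) \<eta>"
          show "((\<lambda>y. H y - y \<bullet> ?D) has_derivative (\<lambda>v. v \<bullet> gradient H y - v \<bullet> ?D))
              (at y within ball (z x) \<eta>)"
            by (intro has_derivative_diff gd bounded_linear_imp_has_derivative
                bounded_linear_inner_left)
          show "onorm (\<lambda>v. v \<bullet> gradient H y - v \<bullet> ?D) \<le> e / 2"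
          proof (rule onorm_bound)
            fix v
            have "norm (v \<bullet> gradient H y - v \<bullet> ?D) \<le> norm v * norm (gradient H y - ?D)"
              by (simp add: inner_diff_right[symmetric] Cauchy_Schwarz_ineq2)
            also have "\<dots> \<le> norm v * (e / 2)"
              using \<eta>(2)[of y] y
              by (intro mult_left_mono) (auto simp: dist_norm norm_minus_commute)
            finally show "norm (v \<bullet> gradient H y - v \<bullet> ?D) \<le> e / 2 * norm v"
              by (simp add: mult_ac)
          qed (use e in simp)
        qed (use near[of c] near[of d] cd in \<open>auto simp: dist_commute\<close>)
        also have "\<dots> \<le> (e / 2) * N"
          using zN e by (intro mult_left_mono) auto
        finally have A: "\<bar>H (z d) - H (z c) - (z d - z c) \<bullet> ?D\<bar> \<le> (e / 2) * N"
          by (simp add: inner_diff_left algebra_simps)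
        have lin: "((\<lambda>s. w s \<bullet> ?D) has_integral (z d - z c) \<bullet> ?D) {c..d}"
          unfolding zd using has_integral_linear[OF integrable_integral[OF wi]
              bounded_linear_inner_left[of ?D]] by (simp add: o_def)
        have "norm (integral {c..d} (\<lambda>s. ?G s - w s \<bullet> ?D))
            \<le> integral {c..d} (\<lambda>s. (e / 2) * norm (w s))"
        proof (rule integral_norm_bound_integral)
          fix s assume s: "s \<in> {c..d}"
          have "norm (?G s - w s \<bullet> ?D) = \<bar>w s \<bullet> (gradient H (z s) - ?D)\<bar>"
            by (simp add: inner_diff_right inner_commute)
          also have "\<dots> \<le> norm (w s) * norm (gradient H (z s) - ?D)"
            by (rule Cauchy_Schwarz_ineq2)
          also have "\<dots> \<le> norm (w s) * (e / 2)"
            using \<eta>(2)[OF near[OF s]] by (intro mult_left_mono) (auto simp: dist_norm)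
          finally show "norm (?G s - w s \<bullet> ?D) \<le> (e / 2) * norm (w s)" by (simp add: mult_ac)
        qed (intro integrable_diff Gi has_integral_integrable[OF lin]
            integrable_on_cmult_left[where 'b = real, simplified] nwi)+
        also have "\<dots> = (e / 2) * N" by (simp add: N_def)
        also have "integral {c..d} (\<lambda>s. ?G s - w s \<bullet> ?D)
            = integral {c..d} ?G - (z d - z c) \<bullet> ?D"
          using integral_unique[OF lin]
          by (simp add: Henstock_Kurzweil_Integration.integral_diff[OF Gi has_integral_integrable[OF lin]])
        finally have "\<bar>integral {c..d} ?G - (z d - z c) \<bullet> ?D\<bar> \<le> (e / 2) * N" by simp
        with A show "\<bar>H (z d) - H (z c) - integral {c..d} ?G\<bar>
            \<le> e * integral {c..d} (\<lambda>s. norm (w s))"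
          unfolding N_def[symmetric] by linarith
      qed
      with \<delta>(1) show ?case by blast
    qed
    then show ?thesis by (simp add: P_def m_def)
  qed
  have m: "m \<ge> 0"
    unfolding m_def by (intro Henstock_Kurzweil_Integration.integral_nonneg sub[OF nw]) auto
  have "\<bar>H (z b) - H (z a) - integral {a..b} ?G\<bar> \<le> 0"
  proof (rule field_le_epsilon)
    fix e :: real assume "e > 0"
    \<comment> \<open>The denominator \<open>m + 1\<close> avoids division by zero when
      \<open>w\<close> vanishes almost everywhere.\<close>
    then have "\<bar>H (z b) - H (z a) - integral {a..b} ?G\<bar> \<le> e / (m + 1) * m"
      using m by (intro est) auto
    also have "\<dots> \<le> e"
      using \<open>e > 0\<close> m by (simp add: field_simps)
    finally show "\<bar>H (z b) - H (z a) - integral {a..b} ?G\<bar> \<le> 0 + e" by simp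
  qed
  then show ?thesis by simp
qed

lemma caratheodory_solution_chain_rule:
  assumes H: "continuously_differentiable H"
    and sol: "caratheodory_solution F {0..T} z0 u z" and ab: "0 \<le> a" "a \<le> b" "b \<le> T"
  shows "H (z b) - H (z a) = integral {a..b} (\<lambda>s. gradient H (z s) \<bullet> F (z s) (u s))"
proof (rule chain_rule_indefinite_integral[OF H _ _ ab(2)])
  show "continuous_on {a..b} z"
    using caratheodory_solution_continuous[OF sol] ab by (auto intro: continuous_on_subset)
  have "(\<lambda>s. F (z s) (u s)) absolutely_integrable_on {0..b}"
    using sol ab by (auto simp: caratheodory_solution_def)
  then show "(\<lambda>s. F (z s) (u s)) absolutely_integrable_on {a..b}"
    by (rule absolutely_integrable_on_subinterval) (use ab in auto)
  show "z d - z c = integral {c..d} (\<lambda>s. F (z s) (u s))" if "a \<le> c" "c \<le> d" "d \<le> b" for c d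
    using that ab by (intro caratheodory_solution_increment[OF sol]) auto
qed

section \<open>Time translation of integrals and solutions\<close>

lemma integral_tail_shift:
  fixes v :: "real \<Rightarrow> 'a::euclidean_space"
  assumes v: "v absolutely_integrable_on {0..}" and T: "0 \<le> T"
  shows "(\<lambda>s. v (s + T)) absolutely_integrable_on {0..}"
    and "integral {0..} v = integral {0..T} v + integral {0..} (\<lambda>s. v (s + T))"
proof -
  have im: "(\<lambda>s. s + T) ` {0..} = {T..}"
    by (auto simp: image_iff intro!: bexI[where x = "_ - T"])
  have vT: "v absolutely_integrable_on {T..}"
    by (rule set_integrable_subset[OF v]) (use T in auto)
  \<comment> \<open>The factor \<open>\<bar>1\<bar>\<close> is the Jacobian of the translation in
    the change of variables formula.\<close>
  have "(\<lambda>s. \<bar>1\<bar> *\<^sub>R v (s + T)) absolutely_integrable_on {0..} \<and>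
      integral {0..} (\<lambda>s. \<bar>1\<bar> *\<^sub>R v (s + T)) = integral {T..} v
    \<longleftrightarrow> v absolutely_integrable_on (\<lambda>s. s + T) ` {0..} \<and>
      integral ((\<lambda>s. s + T) ` {0..}) v = integral {T..} v"
    by (rule has_absolute_integral_change_of_variables_real)
       (auto intro!: derivative_eq_intros inj_onI)
  then have shift: "(\<lambda>s. v (s + T)) absolutely_integrable_on {0..}"
      "integral {0..} (\<lambda>s. v (s + T)) = integral {T..} v"
    using vT by (simp_all add: im)
  show "(\<lambda>s. v (s + T)) absolutely_integrable_on {0..}" by (rule shift)
  have "v integrable_on {0..T}" "v integrable_on {T..}"
    using absolutely_integrable_on_subinterval[OF v, where a = 0 and b = T] vT
    by (auto simp: absolutely_integrable_on_def)
  moreover have "{0..T} \<inter> {T..} = {T}" using T by auto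
  ultimately have "(v has_integral integral {0..T} v + integral {T..} v) ({0..T} \<union> {T..})"
    by (intro has_integral_Un integrable_integral) simp_all
  moreover have "{0..T} \<union> {T..} = {0..}" using T by auto
  ultimately show "integral {0..} v = integral {0..T} v + integral {0..} (\<lambda>s. v (s + T))"
    by (simp add: shift(2) integral_unique)
qed

text \<open>\<open>F\<close> does not depend explicitly on time, so translating the integral
  equation yields the same equation started at \<open>z T\<close>.\<close>

lemma caratheodory_solution_shift:
  assumes sol: "caratheodory_solution F {0..} z0 u z" and T: "0 \<le> T"
  shows "caratheodory_solution F {0..} (z T) (\<lambda>s. u (s + T)) (\<lambda>s. z (s + T))"
  unfolding caratheodory_solution_def
proof (intro ballI conjI)
  fix t :: real assume t: "t \<in> {0..}"
  let ?w = "\<lambda>s. F (z s) (u s)"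
  have "?w absolutely_integrable_on {0..t + T}"
    using sol t T by (auto simp: caratheodory_solution_def)
  then have w: "?w absolutely_integrable_on {T..t + T}"
    by (rule absolutely_integrable_on_subinterval) (use T in auto)
  then show "(\<lambda>s. F (z (s + T)) (u (s + T))) absolutely_integrable_on {0..t}"
    using integrable_shift_real_ivl[of ?w T "t + T" T]
      integrable_shift_real_ivl[of "\<lambda>s. norm (?w s)" T "t + T" T]
    by (auto simp: absolutely_integrable_on_def)
  have "z (t + T) - z T = integral {T..t + T} ?w"
    using t T by (intro caratheodory_solution_increment[OF sol]) auto
  also have "\<dots> = integral {0..t} (\<lambda>s. F (z (s + T)) (u (s + T)))"
    using integral_shift_real_ivl[of T T "t + T" ?w] by simp
  finally show "z (t + T) = z T + integral {0..t} (\<lambda>s. F (z (s + T)) (u (s + T)))"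
    by (simp add: algebra_simps)
qed

subsection \<open>The value function and passivity\<close>

lemma running_cost_nonneg:
  assumes "sym_pos_semidef Q" "sym_pos_semidef R"
  shows "0 \<le> running_cost h Q R z u"
  using assms by (simp add: running_cost_def sym_pos_semidef_def)

lemma total_cost_nonneg:
  assumes "sym_pos_semidef Q" "sym_pos_semidef R" "admissible_pair f g h Q R z0 u z"
  shows "0 \<le> total_cost h Q R u z"
  using assms unfolding total_cost_def admissible_pair_def
  by (auto intro!: Henstock_Kurzweil_Integration.integral_nonneg running_cost_nonneg
      simp: absolutely_integrable_on_def)

text \<open>The infimum is taken in the reals, where it carries information only for a nonempty set;
  this is where the existence of admissible controls enters.\<close>

lemma value_function_nonneg:
  assumes "sym_pos_semidef Q" "sym_pos_semidef R" "admissible_controls f g h Q R z0 \<noteq> {}"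
  shows "0 \<le> value_function f g h Q R z0"
  unfolding value_function_def
proof (rule cInf_greatest)
  show "{total_cost h Q R u z |u z. admissible_pair f g h Q R z0 u z} \<noteq> {}"
    using assms(3) by (auto simp: admissible_controls_def)
qed (use total_cost_nonneg[OF assms(1,2)] in auto)

lemma value_function_le:
  assumes "sym_pos_semidef Q" "sym_pos_semidef R" "admissible_pair f g h Q R z0 u z"
  shows "value_function f g h Q R z0 \<le> total_cost h Q R u z"
  unfolding value_function_def
proof (rule cInf_lower)
  show "bdd_below {total_cost h Q R u z |u z. admissible_pair f g h Q R z0 u z}"
    using total_cost_nonneg[OF assms(1,2)] by (auto intro!: bdd_belowI[where m = 0])
qed (use assms(3) in auto)

lemma L2_controls_shift:
  assumes u: "u \<in> L2_controls" and T: "0 \<le> T"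
  shows "(\<lambda>s. u (s + T)) \<in> L2_controls"
proof -
  have "(\<lambda>s. u (s + T)) \<in> borel_measurable (lebesgue_on {0..})"
  proof -
    \<comment> \<open>Since \<open>u\<close> is only Lebesgue measurable, preimages of Lebesgue sets
      under the translation must be Lebesgue sets; Borel measurability of the translation would be
      too weak.\<close>
    have "(\<lambda>s. s + T) \<in> lebesgue_on {0..} \<rightarrow>\<^sub>M lebesgue_on {0..}"
    proof (rule measurable_restrict_space2)
      show "(\<lambda>s. s + T) \<in> lebesgue_on {0..} \<rightarrow>\<^sub>M lebesgue"
        using lebesgue_affine_measurable[of "\<lambda>_. 1" T]
        by (intro measurable_restrict_space1) (simp add: add.commute)
    qed (use T in auto)
    from measurable_compose[OF this, of u borel] show ?thesis using u by (simp add: L2_controls_def)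
  qed
  then show ?thesis
    using u integral_tail_shift(1)[OF _ T, of "\<lambda>t. (norm (u t))\<^sup>2"] by (simp add: L2_controls_def)
qed

lemma admissible_pair_shift:
  assumes "admissible_pair f g h Q R z0 u z" and T: "0 \<le> T"
  shows "admissible_pair f g h Q R (z T) (\<lambda>s. u (s + T)) (\<lambda>s. z (s + T))"
  using assms(1) L2_controls_shift[OF _ T, of u] caratheodory_solution_shift[OF _ T, of _ z0 u z]
    integral_tail_shift(1)[OF _ T, of "\<lambda>t. running_cost h Q R (z t) (u t)"]
  by (simp add: admissible_pair_def)

text \<open>Optimality is used only at \<open>z0\<close>. From \<open>z T\<close> the tail is merely
  a competitor, so its cost bounds the value there from above.\<close>

lemma value_function_decrease:
  assumes psd: "sym_pos_semidef Q" "sym_pos_semidef R"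
    and adm: "admissible_pair f g h Q R z0 u z" and T: "0 \<le> T"
    and opt: "total_cost h Q R u z = value_function f g h Q R z0"
  shows "value_function f g h Q R (z T) - value_function f g h Q R z0
    \<le> - (1/2) * integral {0..T} (\<lambda>t. running_cost h Q R (z t) (u t))"
proof -
  have "value_function f g h Q R (z T) \<le> total_cost h Q R (\<lambda>s. u (s + T)) (\<lambda>s. z (s + T))"
    by (rule value_function_le[OF psd admissible_pair_shift[OF adm T]])
  moreover have "total_cost h Q R u z
      = (1/2) * integral {0..T} (\<lambda>t. running_cost h Q R (z t) (u t))
        + total_cost h Q R (\<lambda>s. u (s + T)) (\<lambda>s. z (s + T))"
    using integral_tail_shift(2)[OF _ T, of "\<lambda>t. running_cost h Q R (z t) (u t)"] adm
    by (simp add: total_cost_def admissible_pair_def)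
  ultimately show ?thesis using opt by linarith
qed

text \<open>Replaces the one-sided derivative at T = 0: a positive value at 0 would persist, at half
  its size, on a short interval with positive integral.\<close>

lemma nonpos_at_0_if_integrals_nonpos:
  fixes \<phi> :: "real \<Rightarrow> real"
  assumes cont: "continuous_on {0..1} \<phi>"
    and nonpos: "\<And>T. 0 \<le> T \<Longrightarrow> T \<le> 1 \<Longrightarrow> integral {0..T} \<phi> \<le> 0"
  shows "\<phi> 0 \<le> 0"
proof (rule ccontr)
  assume "\<not> \<phi> 0 \<le> 0"
  then have pos: "\<phi> 0 > 0" by simp
  obtain d where d: "d > 0" "\<And>s. s \<in> {0..1} \<Longrightarrow> dist s 0 < d \<Longrightarrow> dist (\<phi> s) (\<phi> 0) < \<phi> 0 / 2"
    using cont pos unfolding continuous_on_iff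
    by (metis half_gt_zero atLeastAtMost_iff order_refl zero_le_one)
  \<comment> \<open>The minimum keeps \<open>T\<close> inside the interval of continuity, and
    halving \<open>d\<close> makes the distance bound strict.\<close>
  define T where "T = min 1 (d / 2)"
  have T: "0 < T" "T \<le> 1" "T < d" using d(1) by (auto simp: T_def)
  have "integral {0..T} (\<lambda>s. \<phi> 0 / 2) \<le> integral {0..T} \<phi>"
  proof (rule integral_le)
    show "\<phi> integrable_on {0..T}"
      by (rule integrable_continuous_real[OF continuous_on_subset[OF cont]]) (use T in auto)
    fix s assume "s \<in> {0..T}"
    then have "\<bar>\<phi> s - \<phi> 0\<bar> < \<phi> 0 / 2"
      using d(2)[of s] T by (simp add: dist_real_def)
    then show "\<phi> 0 / 2 \<le> \<phi> s" by linarith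
  qed auto
  moreover have "integral {0..T} (\<lambda>s. \<phi> 0 / 2) > 0" using T pos by simp
  ultimately show False using nonpos[of T] T by linarith
qed

lemma continuous_on_matrix_vector_mult:
  fixes A :: "'a::topological_space \<Rightarrow> real^'n^'m"
  assumes "continuous_on S A" "continuous_on S v"
  shows "continuous_on S (\<lambda>x. A x *v v x)"
  unfolding matrix_vector_mult_def using assms by (intro continuous_intros) auto

lemma continuous_on_transpose:
  fixes A :: "'a::topological_space \<Rightarrow> real^'n^'m"
  assumes "continuous_on S A"
  shows "continuous_on S (\<lambda>x. transpose (A x))"
  unfolding transpose_def using assms by (intro continuous_intros) auto

text \<open>The optimal trajectory depends on \<open>z0\<close>, but at time 0 it sits at
  \<open>z0\<close>. Evaluating there removes the trajectory and leaves an inequality in the state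
  alone.\<close>

lemma optimal_feedback_HJB_inequality:
  assumes f: "continuous_on UNIV f" and g: "continuous_on UNIV g" and h: "continuous_on UNIV h"
    and psd: "sym_pos_semidef Q" "sym_pos_semidef R"
    and H: "continuously_differentiable (value_function f g h Q R)"
    and k: "continuous_on UNIV k" and opt: "optimal_feedback f g h Q R k"
  shows "gradient (value_function f g h Q R) z0 \<bullet> plant f g z0 (k z0)
    \<le> - (1/2) * running_cost h Q R z0 (k z0)"
proof -
  let ?V = "value_function f g h Q R"
  obtain z where adm: "admissible_pair f g h Q R z0 (\<lambda>t. k (z t)) z"
    and cost: "total_cost h Q R (\<lambda>t. k (z t)) z = ?V z0"
    using opt unfolding optimal_feedback_def by blast
  have sol: "caratheodory_solution (plant f g) {0..} z0 (\<lambda>t. k (z t)) z"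
    using adm by (simp add: admissible_pair_def)
  \<comment> \<open>Only small times matter, so the trajectory is cut to a compact interval, where
    the continuity and chain rule lemmas apply.\<close>
  then have sol1: "caratheodory_solution (plant f g) {0..1} z0 (\<lambda>t. k (z t)) z"
    by (simp add: caratheodory_solution_def)
  have z0: "z 0 = z0" using caratheodory_solution_initial[OF sol1] by simp
  have zc: "continuous_on {0..1} z" by (rule caratheodory_solution_continuous[OF sol1])
  have gV: "continuous_on UNIV (gradient ?V)"
    using H by (simp add: continuously_differentiable_def)
  note comp = continuous_on_compose2[OF _ zc subset_UNIV]
  define \<psi> where "\<psi> t = gradient ?V (z t) \<bullet> plant f g (z t) (k (z t))" for t
  define l where "l t = running_cost h Q R (z t) (k (z t))" for t
  have \<psi>c: "continuous_on {0..1} \<psi>"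
    unfolding \<psi>_def plant_def
    by (intro continuous_intros continuous_on_matrix_vector_mult comp[OF f] comp[OF g] comp[OF k]
        comp[OF gV])
  have lc: "continuous_on {0..1} l"
    unfolding l_def running_cost_def
    by (intro continuous_intros continuous_on_matrix_vector_mult comp[OF h] comp[OF k])
  have "\<psi> 0 + (1/2) * l 0 \<le> 0"
  proof (rule nonpos_at_0_if_integrals_nonpos[where \<phi> = "\<lambda>t. \<psi> t + (1/2) * l t"])
    show "continuous_on {0..1} (\<lambda>t. \<psi> t + (1/2) * l t)"
      by (intro continuous_intros \<psi>c lc)
    fix T :: real assume T: "0 \<le> T" "T \<le> 1"
    have "\<psi> integrable_on {0..T}" "l integrable_on {0..T}"
      using T by (auto intro!: integrable_continuous_real
          intro: continuous_on_subset[OF \<psi>c] continuous_on_subset[OF lc])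
    then have "integral {0..T} (\<lambda>t. \<psi> t + (1/2) * l t)
        = integral {0..T} \<psi> + (1/2) * integral {0..T} l"
      by (subst Henstock_Kurzweil_Integration.integral_add) auto
    also have "integral {0..T} \<psi> = ?V (z T) - ?V z0"
      using caratheodory_solution_chain_rule[OF H sol1, of 0 T] T unfolding \<psi>_def by (simp add: z0)
    finally show "integral {0..T} (\<lambda>t. \<psi> t + (1/2) * l t) \<le> 0"
      using value_function_decrease[OF psd adm T(1) cost] by (simp add: l_def)
  qed
  then show ?thesis by (simp add: \<psi>_def l_def z0)
qed

theorem theorem2:
  fixes f :: "real^'n \<Rightarrow> real^'n"
    and g :: "real^'n \<Rightarrow> real^'m^'n"
    and h :: "real^'n \<Rightarrow> real^'m"
    and Q R :: "real^'m^'m"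
    and Hhat :: "real^'n \<Rightarrow> real"
  assumes "continuous_on UNIV f" and "continuous_on UNIV g" and "continuous_on UNIV h"
    and "f 0 = 0"
    and "sym_pos_semidef Q" and "sym_pos_semidef R" and "invertible R"
    and "\<And>z0 u. u \<in> L2_controls \<Longrightarrow> \<exists>z. caratheodory_solution (plant f g) {0..} z0 u z"
    and "Hhat = value_function f g h Q R"
    and "\<And>z0. admissible_controls f g h Q R z0 \<noteq> {}"
    and "continuously_differentiable Hhat"
    and "optimal_feedback f g h Q R
           (\<lambda>z. - (matrix_inv R *v (transpose (g z) *v gradient Hhat z)))"
  shows "passive_with_storage
           (\<lambda>z u. f z - g z *v (matrix_inv R *v (transpose (g z) *v gradient Hhat z))
                   + g z *v (matrix_inv (matrix_sqrt R) *v (u - matrix_sqrt Q *v h z)))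
           (\<lambda>z. matrix_inv (matrix_sqrt R) *v (transpose (g z) *v gradient Hhat z))
           Hhat"
proof -
  note f = assms(1) and g = assms(2) and h = assms(3) and Q = assms(5) and R = assms(6,7)
    and Hhat = assms(9) and H = assms(11) and opt = assms(12)
  let ?V = "matrix_inv (matrix_sqrt R)" and ?p = "gradient Hhat" and ?S = "matrix_sqrt Q"
  let ?k = "\<lambda>z. - (matrix_inv R *v (transpose (g z) *v ?p z))"
  let ?y = "\<lambda>z. ?V *v (transpose (g z) *v ?p z)"
  let ?F = "\<lambda>z u. f z - g z *v (matrix_inv R *v (transpose (g z) *v ?p z))
                   + g z *v (?V *v (u - ?S *v h z))"
  have pc: "continuous_on UNIV ?p" using H by (simp add: continuously_differentiable_def)
  have gtc: "continuous_on UNIV (\<lambda>z. transpose (g z) *v ?p z)"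
    by (intro continuous_on_matrix_vector_mult continuous_on_transpose g pc)
  have kc: "continuous_on UNIV ?k" and yc: "continuous_on UNIV ?y"
    by (intro continuous_intros continuous_on_matrix_vector_mult gtc)+
  \<comment> \<open>Input and output are collocated: the new input enters through g R^{-1/2}, and
    the output is the transpose of that matrix applied to the gradient.\<close>
  have gV: "?p z \<bullet> (g z *v (?V *v w)) = ?y z \<bullet> w" for z w
    by (simp add: inner_matrix_vector_transpose[of _ "g z"] matrix_inv_sqrt_inner_swap[OF R])
  have gR: "?p z \<bullet> (g z *v (matrix_inv R *v (transpose (g z) *v ?p z))) = (norm (?y z))\<^sup>2" for z
    unfolding matrix_inv_sqrt_square[OF R, symmetric] gV by (simp add: power2_norm_eq_inner)
  have kR: "?k z \<bullet> (R *v ?k z) = (norm (?y z))\<^sup>2" for z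
  proof -
    let ?a = "transpose (g z) *v ?p z"
    have "R *v (matrix_inv R *v ?a) = ?a"
      by (simp add: matrix_vector_mul_assoc matrix_inv_right_left[OF R(2)])
    moreover have "R *v (- w) = - (R *v w)" for w
      using matrix_vector_mult_diff_distrib[of R 0 w] by simp
    ultimately have "?k z \<bullet> (R *v ?k z) = (?V *v (?V *v ?a)) \<bullet> ?a"
      by (simp add: matrix_inv_sqrt_square[OF R])
    also have "\<dots> = (norm (?y z))\<^sup>2"
      by (simp add: matrix_inv_sqrt_inner_swap[OF R, symmetric] power2_norm_eq_inner)
    finally show ?thesis .
  qed
  have hQ: "h z \<bullet> (Q *v h z) = (norm (?S *v h z))\<^sup>2" for z
  proof -
    have "Q *v h z = ?S *v (?S *v h z)"
      by (simp add: matrix_vector_mul_assoc matrix_sqrt_square[OF Q])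
    then show ?thesis
      by (simp add: sym_pos_semidef_inner_swap[OF sym_pos_semidef_matrix_sqrt[OF Q]]
          power2_norm_eq_inner)
  qed
  \<comment> \<open>Dissipation at an arbitrary pair of state and input value, without reference to
    any solution.\<close>
  have diss: "?p z \<bullet> ?F z u \<le> ?y z \<bullet> u" for z u
  proof -
    have "g z *v ?k z = - (g z *v (matrix_inv R *v (transpose (g z) *v ?p z)))"
      using matrix_vector_mult_diff_distrib[of "g z" 0] by simp
    then have "?p z \<bullet> f z - (norm (?y z))\<^sup>2
        \<le> - (1/2) * ((norm (?S *v h z))\<^sup>2 + (norm (?y z))\<^sup>2)"
      using optimal_feedback_HJB_inequality[OF f g h Q R(1) H[unfolded Hhat] kc[unfolded Hhat]
          opt[unfolded Hhat], folded Hhat, of z]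
      by (simp only: plant_def running_cost_def kR hQ inner_add_right inner_minus_right gR)
    moreover have "?p z \<bullet> ?F z u
        = ?p z \<bullet> f z - (norm (?y z))\<^sup>2 + ?y z \<bullet> u - ?y z \<bullet> (?S *v h z)"
      by (simp only: inner_add_right inner_diff_right gR gV)
    \<comment> \<open>Half of this square is exactly what separates the bound on the rate from the
      supply \<open>?y z \<bullet> u\<close>.\<close>
    moreover have "0 \<le> (norm (?y z + ?S *v h z))\<^sup>2" by simp
    then have "0 \<le> (norm (?y z))\<^sup>2 + 2 * (?y z \<bullet> (?S *v h z)) + (norm (?S *v h z))\<^sup>2"
      by (simp only: power2_norm_eq_inner inner_add_left inner_add_right
          inner_commute[of "?S *v h z" "?y z"])
    ultimately show ?thesis by (simp only: distrib_left)
  qed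
  show ?thesis
    unfolding passive_with_storage_def
  proof (intro conjI allI impI)
    show "0 \<le> Hhat z" for z
      unfolding Hhat by (rule value_function_nonneg[OF Q R(1) assms(10)])
    fix z0 u z and t0 t1 :: real
    assume t: "0 \<le> t0" "t0 \<le> t1" and u: "u absolutely_integrable_on {0..t1}"
      and sol: "caratheodory_solution ?F {0..t1} z0 u z"
    have zc: "continuous_on {t0..t1} z"
      using caratheodory_solution_continuous[OF sol] t by (auto intro: continuous_on_subset)
    have w: "(\<lambda>t. ?F (z t) (u t)) absolutely_integrable_on {t0..t1}"
      by (rule absolutely_integrable_on_subinterval[where S = "{0..t1}"])
         (use sol t in \<open>auto simp: caratheodory_solution_def\<close>)
    have u': "u absolutely_integrable_on {t0..t1}"
      by (rule absolutely_integrable_on_subinterval[OF u]) (use t in auto)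
    \<comment> \<open>The output is continuous in time along the solution, so an integrable input is
      enough for an integrable supply rate.\<close>
    show power: "(\<lambda>t. ?y (z t) \<bullet> u t) absolutely_integrable_on {t0..t1}"
      using continuous_on_compose2[OF yc zc]
      by (intro absolutely_integrable_continuous_inner u') auto
    have rate: "(\<lambda>t. ?p (z t) \<bullet> ?F (z t) (u t)) absolutely_integrable_on {t0..t1}"
      using continuous_on_compose2[OF pc zc]
      by (intro absolutely_integrable_continuous_inner w) auto
    have "Hhat (z t1) - Hhat (z t0) = integral {t0..t1} (\<lambda>t. ?p (z t) \<bullet> ?F (z t) (u t))"
      by (rule caratheodory_solution_chain_rule[OF H sol]) (use t in auto)
    also have "\<dots> \<le> integral {t0..t1} (\<lambda>t. ?y (z t) \<bullet> u t)"
      using power rate diss by (intro integral_le) (auto simp: absolutely_integrable_on_def)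
    finally show "Hhat (z t1) - Hhat (z t0) \<le> integral {t0..t1} (\<lambda>t. ?y (z t) \<bullet> u t)" .
  qed
qed

end
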